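(* Let $G$ be a global amoeba which is the vertex-disjoint union $G=H'\cup H''$ of two subgraphs $H'$ and $H''$ with $E(G)=E(H')\cup E(H'')$ ($H''$ is allowed to be the null graph, in which case $G=H'$). Let $H$ be a copy of $H'$ that is vertex-disjoint from $G$. Then: (i) for any $e\in E(\overline H)$, the graph $G\cup(H+e)$ is a global amoeba; (ii) for any $e\in E(H)$, the graph $G\cup(H-e)$ is a global amoeba.
   Context: For a graph $G$ on vertex set $V=\{v_1,\dots,v_n\}$ let $L_G=\{ij: v_iv_j\in E(G)\}$; for $\sigma\in S_n$, $G_\sigma$ is the graph on $V$ with $E(G_\sigma)=\{v_{\sigma^{-1}(i)}v_{\sigma^{-1}(j)}: ij\in L_G\}$. An edge-replacement $e\to e'$ ($e\in E(G)$, $e'\in E(\overline G)\cup\{e\}$) is feasible if $G-e+e'\cong G$. Let $R_G$ be the set of feasible replacements $rs\to kl$ (meaning $v_rv_s\to v_kv_l$), $S_G(rs\to kl)=\{\sigma\in S_n: G_\sigma=G-v_rv_s+v_kv_l\}$, and $S_G\le S_n$ the group generated by $\bigcup_{rs\to kl\in R_G}S_G(rs\to kl)$. $G$ is a local amoeba if $S_G=S_n$; $G$ is a global amoeba if there is $T\ge0$ such that $G\cup tK_1$ ($G$ plus $t$ isolated vertices) is a local amoeba for all $t\ge T$. *)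

theory Defs
  imports "HOL-Algebra.Sym_Groups"
begin

datatype 'a graph = Graph (verts: "'a set") (edges: "'a set set")

definition simple_graph :: "'a graph \<Rightarrow> bool" where
  "simple_graph G \<longleftrightarrow>
     finite (verts G) \<and> (\<forall>e\<in>edges G. e \<subseteq> verts G \<and> card e = 2)"

definition graph_iso :: "'a graph \<Rightarrow> 'b graph \<Rightarrow> bool"  (infix "\<cong>\<^sub>g" 50) where
  "G \<cong>\<^sub>g H \<longleftrightarrow>
     (\<exists>f. bij_betw f (verts G) (verts H) \<and>
          (\<forall>u\<in>verts G. \<forall>w\<in>verts G. {u, w} \<in> edges G \<longleftrightarrow> {f u, f w} \<in> edges H))"

definition graph_compl :: "'a graph \<Rightarrow> 'a graph" where
  "graph_compl G =
     Graph (verts G) ({{u, w} |u w. u \<in> verts G \<and> w \<in> verts G \<and> u \<noteq> w} - edges G)"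

definition add_edge :: "'a graph \<Rightarrow> 'a set \<Rightarrow> 'a graph" where
  "add_edge G e = Graph (verts G) (insert e (edges G))"

definition del_edge :: "'a graph \<Rightarrow> 'a set \<Rightarrow> 'a graph" where
  "del_edge G e = Graph (verts G) (edges G - {e})"

definition graph_union :: "'a graph \<Rightarrow> 'a graph \<Rightarrow> 'a graph"  (infixl "\<union>\<^sub>g" 65) where
  "G \<union>\<^sub>g H = Graph (verts G \<union> verts H) (edges G \<union> edges H)"

text \<open>
  The graph \<open>G \<union> t K\<^sub>1\<close>. The sum type supplies the new vertices, so that there are always
  enough of them, whatever the vertex type of \<open>G\<close>.
\<close>

definition add_isolated :: "'a graph \<Rightarrow> nat \<Rightarrow> ('a + nat) graph" where
  "add_isolated G t = Graph (Inl ` verts G \<union> Inr ` {..<t}) ((`) Inl ` edges G)"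

text \<open>
  A labelling \<open>v\<close> writes the vertex set as \<open>{v 1, \<dots>, v n}\<close> with \<open>n\<close> the number of vertices.
\<close>

definition labelling :: "(nat \<Rightarrow> 'a) \<Rightarrow> 'a graph \<Rightarrow> bool" where
  "labelling v G \<longleftrightarrow> bij_betw v {1..card (verts G)} (verts G)"

definition edge_labels :: "(nat \<Rightarrow> 'a) \<Rightarrow> 'a graph \<Rightarrow> nat set set" where
  "edge_labels v G =
     {{i, j} |i j. i \<in> {1..card (verts G)} \<and> j \<in> {1..card (verts G)} \<and> {v i, v j} \<in> edges G}"

definition permuted_graph :: "(nat \<Rightarrow> 'a) \<Rightarrow> 'a graph \<Rightarrow> (nat \<Rightarrow> nat) \<Rightarrow> 'a graph" where
  "permuted_graph v G \<sigma> =
     Graph (verts G) {{v (inv' \<sigma> i), v (inv' \<sigma> j)} |i j. {i, j} \<in> edge_labels v G}"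

definition feasible :: "'a graph \<Rightarrow> 'a set \<Rightarrow> 'a set \<Rightarrow> bool" where
  "feasible G e e' \<longleftrightarrow>
     e \<in> edges G \<and> e' \<in> edges (graph_compl G) \<union> {e} \<and>
     add_edge (del_edge G e) e' \<cong>\<^sub>g G"

text \<open>
  A replacement \<open>rs \<rightarrow> kl\<close> is represented by the pair \<open>({r, s}, {k, l})\<close> of label sets;
  the image \<open>v ` {r, s}\<close> is the vertex pair \<open>{v r, v s}\<close>.
\<close>

definition feasible_replacements :: "(nat \<Rightarrow> 'a) \<Rightarrow> 'a graph \<Rightarrow> (nat set \<times> nat set) set" where
  "feasible_replacements v G =
     {(rs, kl). rs \<subseteq> {1..card (verts G)} \<and> kl \<subseteq> {1..card (verts G)} \<and>
                feasible G (v ` rs) (v ` kl)}"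

definition replacement_perms ::
  "(nat \<Rightarrow> 'a) \<Rightarrow> 'a graph \<Rightarrow> nat set \<Rightarrow> nat set \<Rightarrow> (nat \<Rightarrow> nat) set" where
  "replacement_perms v G rs kl =
     {\<sigma> \<in> carrier (sym_group (card (verts G))).
        permuted_graph v G \<sigma> = add_edge (del_edge G (v ` rs)) (v ` kl)}"

definition amoeba_group :: "(nat \<Rightarrow> 'a) \<Rightarrow> 'a graph \<Rightarrow> (nat \<Rightarrow> nat) set" where
  "amoeba_group v G =
     generate (sym_group (card (verts G)))
       (\<Union>(rs, kl)\<in>feasible_replacements v G. replacement_perms v G rs kl)"

text \<open>
  The groups obtained from two labellings of the same graph are conjugate, so it does not matter
  which labelling is used.
\<close>

definition local_amoeba :: "'a graph \<Rightarrow> bool" where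
  "local_amoeba G \<longleftrightarrow>
     (\<exists>v. labelling v G \<and> amoeba_group v G = carrier (sym_group (card (verts G))))"

definition global_amoeba :: "'a graph \<Rightarrow> bool" where
  "global_amoeba G \<longleftrightarrow> (\<exists>T. \<forall>t\<ge>T. local_amoeba (add_isolated G t))"

end

theory Submission
  imports Defs
begin

text \<open>
  Relabelling shows that a graph is a local amoeba iff the permutations of its vertex set that
  change at most one edge generate the whole symmetric group. Let \<open>F\<close> be \<open>G \<union> (H \<plusminus> e)\<close> together
  with enough isolated vertices. The permutations fixing \<open>V(H)\<close> pointwise are generated because
  \<open>G\<close> is a global amoeba. The involution that swaps \<open>H\<close> with its copy \<open>H'\<close> inside \<open>G\<close> only
  moves the edge \<open>e\<close>, respectively its counterpart in \<open>H'\<close>, so it is a generator, and conjugation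
  by it yields the permutations fixing \<open>V(H')\<close> pointwise. As \<open>V(H)\<close> and \<open>V(H')\<close> are disjoint and
  miss some vertex \<open>z\<close>, all transpositions \<open>(a z)\<close> are obtained.
\<close>

section \<open>Local amoebas without labellings\<close>

text \<open>
  That \<open>b\<close> is a new edge or \<open>a\<close> itself need not be demanded: for finite edge sets it follows by
  counting. The choice \<open>b = a\<close> gives the automorphisms, unless \<open>G\<close> has no edges.
\<close>

definition replacing_perm :: "'a graph \<Rightarrow> ('a \<Rightarrow> 'a) \<Rightarrow> bool" where
  "replacing_perm G p \<longleftrightarrow> p permutes verts G \<and>
     (\<exists>a\<in>edges G. \<exists>b. (`) p ` edges G = insert b (edges G - {a}))"

text \<open>There is no rule for inverses: over a simple graph the generators are closed under
  inversion (\<open>replacing_perm_inv\<close>), so their finite products already form the generated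
  group.\<close>

inductive_set replacing_closure :: "'a graph \<Rightarrow> ('a \<Rightarrow> 'a) set" for G where
  id: "id \<in> replacing_closure G"
| step: "replacing_perm G p \<Longrightarrow> q \<in> replacing_closure G \<Longrightarrow> p \<circ> q \<in> replacing_closure G"

lemma replacing_closure_incl: "replacing_perm G p \<Longrightarrow> p \<in> replacing_closure G"
  using replacing_closure.step[OF _ replacing_closure.id] by fastforce

lemma replacing_closure_comp:
  assumes "p \<in> replacing_closure G" "q \<in> replacing_closure G"
  shows "p \<circ> q \<in> replacing_closure G"
  using assms by (induction) (auto simp: comp_assoc intro: replacing_closure.step)

section \<open>Inverses of permutations that replace one edge\<close>

lemma simple_graph_finite_edges: "simple_graph G \<Longrightarrow> finite (edges G)"
  unfolding simple_graph_def by (rule finite_subset[of _ "Pow (verts G)"]) auto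

lemma simple_graph_edgeE:
  assumes "simple_graph G" "e \<in> edges G"
  obtains x y where "e = {x, y}" "x \<in> verts G" "y \<in> verts G" "x \<noteq> y"
proof -
  have "card e = 2" "e \<subseteq> verts G"
    using assms unfolding simple_graph_def by auto
  then show thesis
    using that by (auto simp: card_2_iff)
qed

text \<open>If \<open>b\<close> were among the edges that remain, the image would have one edge
  fewer than \<open>E\<close>, contradicting injectivity. The case \<open>b = a\<close> stays
  possible.\<close>

lemma replaced_edge_fresh:
  assumes "finite E" "inj_on f E" "a \<in> E" "f ` E = insert b (E - {a})"
  shows "b \<notin> E - {a}"
proof
  assume "b \<in> E - {a}"
  then have "f ` E = E - {a}"
    using assms by auto
  then have "card E = card (E - {a})"
    using assms(2) card_image by metis
  then show False
    using assms(1,3) by (metis card_Diff1_less less_irrefl)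
qed

text \<open>Solve the replacement equation for the old edge set and apply \<open>inv' p\<close>: the
  inverse removes \<open>inv' p\<close> b\<open>and inserts\<close>inv' p \<open>a\<close>.\<close>

lemma replacing_perm_inv:
  assumes "simple_graph G" "replacing_perm G p"
  shows "replacing_perm G (inv' p)"
proof -
  let ?E = "edges G"
  obtain a b where p: "p permutes verts G" and a: "a \<in> ?E"
    and ab: "(`) p ` ?E = insert b (?E - {a})"
    using assms(2) unfolding replacing_perm_def by auto
  have inj: "inj ((`) p)"
    using p by (auto simp: inj_image_eq_iff permutes_inj intro!: injI)
  have "b \<notin> ?E - {a}"
    using replaced_edge_fresh[OF simple_graph_finite_edges[OF assms(1)] _ a ab] inj
    by (meson inj_on_subset subset_UNIV)
  \<comment> \<open>Freshness enters here: removing \<open>b\<close> from the image must give back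
    exactly \<open>?E - {a}\<close>.\<close>
  then have E: "?E = insert a ((`) p ` ?E - {b})"
    using a ab by auto
  have cancel: "inv' p ` p ` x = x" for x
    using p by (simp add: image_comp permutes_inv_o)
  have inj': "inj ((`) (inv' p))"
    using permutes_inv[OF p] by (auto simp: inj_image_eq_iff permutes_inj intro!: injI)
  have "(`) (inv' p) ` ?E = (`) (inv' p) ` insert a ((`) p ` ?E - {b})"
    using E by simp
  also have "\<dots> = insert (inv' p ` a) ((`) (inv' p) ` (`) p ` ?E - {inv' p ` b})"
    by (simp add: image_set_diff[OF inj'])
  also have "(`) (inv' p) ` (`) p ` ?E = ?E"
    by (subst image_image) (simp only: cancel image_ident)
  finally have eq: "(`) (inv' p) ` ?E = insert (inv' p ` a) (?E - {inv' p ` b})" .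
  have "b \<in> (`) p ` ?E"
    using ab by simp
  then have "inv' p ` b \<in> ?E"
    using cancel by auto
  then show ?thesis
    unfolding replacing_perm_def using eq permutes_inv[OF p] by blast
qed

section \<open>Translation between label permutations and vertex permutations\<close>

lemma permuted_graph_eq:
  assumes "simple_graph G" "labelling v G" "s permutes {1..card (verts G)}"
  shows "permuted_graph v G s =
    Graph (verts G) ((`) (map_permutation {1..card (verts G)} v (inv' s)) ` edges G)"
proof -
  let ?I = "{1..card (verts G)}"
  let ?p = "map_permutation ?I v (inv' s)"
  have v: "bij_betw v ?I (verts G)"
    using assms(2) unfolding labelling_def .
  have p: "?p (v i) = v (inv' s i)" if "i \<in> ?I" for i
    using that v by (intro map_permutation_apply) (auto simp: bij_betw_def)
  have lab: "i \<in> ?I \<and> j \<in> ?I \<and> {v i, v j} \<in> edges G" if ij: "{i, j} \<in> edge_labels v G" for i j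
  proof -
    obtain i' j' where *: "{i, j} = {i', j'}" "i' \<in> ?I" "j' \<in> ?I" "{v i', v j'} \<in> edges G"
      using ij unfolding edge_labels_def by blast
    then have "{v i, v j} = {v i', v j'}"
      by (metis image_empty image_insert)
    then show ?thesis
      using * by (metis empty_subsetI insert_subset)
  qed
  have "{{v (inv' s i), v (inv' s j)} |i j. {i, j} \<in> edge_labels v G} = (`) ?p ` edges G"
  proof (intro equalityI subsetI)
    fix e
    assume "e \<in> {{v (inv' s i), v (inv' s j)} |i j. {i, j} \<in> edge_labels v G}"
    then obtain i j where e: "e = {v (inv' s i), v (inv' s j)}" and ij: "{i, j} \<in> edge_labels v G"
      by blast
    have "e = ?p ` {v i, v j}"
      using lab[OF ij] e p by simp
    then show "e \<in> (`) ?p ` edges G"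
      using lab[OF ij] by blast
  next
    fix e
    assume "e \<in> (`) ?p ` edges G"
    then obtain d where d: "d \<in> edges G" "e = ?p ` d"
      by blast
    obtain x y where xy: "d = {x, y}" "x \<in> verts G" "y \<in> verts G"
      using simple_graph_edgeE[OF assms(1) d(1)] by metis
    then obtain i j where ij: "i \<in> ?I" "j \<in> ?I" "x = v i" "y = v j"
      using v unfolding bij_betw_def by blast
    then have "{i, j} \<in> edge_labels v G"
      using d xy unfolding edge_labels_def by blast
    moreover have "e = {v (inv' s i), v (inv' s j)}"
      using d(2) xy(1) ij p by simp
    ultimately show "e \<in> {{v (inv' s i), v (inv' s j)} |i j. {i, j} \<in> edge_labels v G}"
      by blast
  qed
  then show ?thesis
    unfolding permuted_graph_def by simp
qed

text \<open>This makes the isomorphism clause of \<open>feasible\<close> automatic for a graph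
  obtained by permuting vertices. The isomorphism leads back to \<open>G\<close>, hence the witness
  \<open>inv' p\<close>.\<close>

lemma graph_iso_permuted:
  assumes "p permutes verts G"
  shows "Graph (verts G) ((`) p ` edges G) \<cong>\<^sub>g G"
proof -
  have "{u, w} \<in> (`) p ` edges G \<longleftrightarrow> {inv' p u, inv' p w} \<in> edges G" for u w
  proof
    assume "{u, w} \<in> (`) p ` edges G"
    then obtain e where e: "e \<in> edges G" "{u, w} = p ` e"
      by blast
    then have "inv' p ` {u, w} = e"
      using assms by (simp add: image_comp permutes_inv_o)
    then show "{inv' p u, inv' p w} \<in> edges G"
      using e(1) by simp
  next
    assume "{inv' p u, inv' p w} \<in> edges G"
    moreover have "p ` {inv' p u, inv' p w} = {u, w}"
      using assms by (simp add: permutes_inverses)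
    ultimately show "{u, w} \<in> (`) p ` edges G"
      by (metis imageI)
  qed
  then show ?thesis
    unfolding graph_iso_def using permutes_imp_bij[OF permutes_inv[OF assms]]
    by (intro exI[of _ "inv' p"]) simp
qed

text \<open>A permuted graph sends the vertex \<open>v i\<close> to \<open>v (inv' s i)\<close>, so
  a label permutation acts on vertices through the transport of its inverse. Conversely, a
  permutation that replaces one edge determines a feasible replacement, by counting edges and by
  \<open>graph_iso_permuted\<close>.\<close>

lemma Union_replacement_perms_eq:
  assumes G: "simple_graph G" and lab: "labelling v G"
  defines "I \<equiv> {1..card (verts G)}"
  shows "(\<Union>(rs, kl)\<in>feasible_replacements v G. replacement_perms v G rs kl) =
    {s. s permutes I \<and> replacing_perm G (map_permutation I v (inv' s))}" (is "?L = ?R")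
proof (intro equalityI subsetI)
  have v: "bij_betw v I (verts G)"
    using lab unfolding labelling_def I_def .
  fix s
  {
    assume "s \<in> ?L"
    then obtain rs kl where "feasible G (v ` rs) (v ` kl)" and s: "s permutes I"
      and eq: "permuted_graph v G s = add_edge (del_edge G (v ` rs)) (v ` kl)"
      unfolding feasible_replacements_def replacement_perms_def I_def sym_group_carrier by auto
    moreover have "(`) (map_permutation I v (inv' s)) ` edges G
        = insert (v ` kl) (edges G - {v ` rs})"
      using eq permuted_graph_eq[OF G lab] s unfolding I_def add_edge_def del_edge_def by simp
    ultimately show "s \<in> ?R"
      using map_permutation_permutes[OF v permutes_inv[OF s]]
      unfolding replacing_perm_def feasible_def by blast
  next
    assume "s \<in> ?R"
    define p where "p = map_permutation I v (inv' s)"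
    from \<open>s \<in> ?R\<close> have s: "s permutes I" and "replacing_perm G p"
      unfolding p_def by auto
    then obtain a b where p: "p permutes verts G" and a: "a \<in> edges G"
      and ab: "(`) p ` edges G = insert b (edges G - {a})"
      unfolding replacing_perm_def by auto
    have "inj ((`) p)"
      using p by (auto simp: inj_image_eq_iff permutes_inj intro!: injI)
    then have fresh: "b \<notin> edges G - {a}"
      using replaced_edge_fresh[OF simple_graph_finite_edges[OF G] _ a ab]
      by (meson inj_on_subset subset_UNIV)
    have "b \<in> (`) p ` edges G"
      using ab by simp
    then obtain e where e: "e \<in> edges G" "b = p ` e"
      by blast
    obtain x y where xy: "e = {x, y}" "x \<in> verts G" "y \<in> verts G" "x \<noteq> y"
      using simple_graph_edgeE[OF G e(1)] .
    have "b = {p x, p y}" "p x \<in> verts G" "p y \<in> verts G" "p x \<noteq> p y"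
      using e xy p permutes_inj[OF p] by (auto simp: permutes_in_image inj_eq)
    then have b: "b \<subseteq> verts G" "b \<in> edges (graph_compl G) \<union> {a}"
      using fresh unfolding graph_compl_def by auto
    have asub: "a \<subseteq> verts G"
      using G a unfolding simple_graph_def by blast
    have eq: "Graph (verts G) ((`) p ` edges G) = add_edge (del_edge G a) b"
      using ab unfolding add_edge_def del_edge_def by simp
    have feas: "feasible G a b"
      unfolding feasible_def using a b graph_iso_permuted[OF p] eq by simp
    obtain rs where rs: "rs \<subseteq> I" "a = v ` rs"
      using asub v unfolding bij_betw_def by (metis subset_imageE)
    obtain kl where kl: "kl \<subseteq> I" "b = v ` kl"
      using b(1) v unfolding bij_betw_def by (metis subset_imageE)
    have "(rs, kl) \<in> feasible_replacements v G"
      unfolding feasible_replacements_def using rs kl feas I_def by auto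
    moreover have "s \<in> replacement_perms v G rs kl"
      unfolding replacement_perms_def sym_group_carrier
      using s eq permuted_graph_eq[OF G lab] rs kl unfolding I_def p_def by simp
    ultimately show "s \<in> ?L"
      by blast
  }
qed

text \<open>Transport along \<open>v\<close> respects composition, and the inverse in the
  description of the generators disappears because replacing permutations are closed under
  inversion. Both inclusions are inductions over words in the generators.\<close>

lemma amoeba_group_eq:
  assumes G: "simple_graph G" and lab: "labelling v G"
  defines "I \<equiv> {1..card (verts G)}"
  shows "amoeba_group v G =
    {s. s permutes I \<and> map_permutation I v s \<in> replacing_closure G}"
proof (intro equalityI subsetI)
  let ?S = "sym_group (card (verts G))"
  let ?c = "map_permutation I v"
  let ?gens = "{s. s permutes I \<and> replacing_perm G (?c (inv' s))}"
  have v: "bij_betw v I (verts G)"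
    using lab unfolding labelling_def I_def .
  then have inj: "inj_on v I"
    by (simp add: bij_betw_def)
  have gen: "amoeba_group v G = generate ?S ?gens"
    unfolding amoeba_group_def Union_replacement_perms_eq[OF G lab] I_def ..
  have comp: "?c (s \<circ> t) = ?c s \<circ> ?c t" if "t permutes I" for s t
    using map_permutation_compose'[OF inj that] .
  have c_inv: "?c (inv' s) = inv' (?c s)" if s: "s permutes I" for s
  proof -
    have "?c (inv' s) \<circ> ?c s = id"
      using comp[OF s, of "inv' s"] s map_permutation_id'[OF inj] by (simp add: permutes_inv_o)
    moreover have "surj (?c s)"
      using map_permutation_permutes[OF v s] by (rule permutes_surj)
    ultimately show ?thesis
      by (metis o_inv_distrib inv_unique_comp permutes_inv_o(1) map_permutation_permutes[OF v s]
          comp_assoc comp_id id_comp)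
  qed
  have repl: "replacing_perm G (?c s)" if "s permutes I" "replacing_perm G (?c (inv' s))" for s
    using replacing_perm_inv[OF G that(2)] c_inv[OF permutes_inv[OF that(1)]] that(1)
    by (simp add: permutes_inv_inv)
  fix s
  {
    assume "s \<in> amoeba_group v G"
    then have "s \<in> generate ?S ?gens"
      using gen by simp
    then show "s \<in> {s. s permutes I \<and> ?c s \<in> replacing_closure G}"
    proof induction
      case one
      then show ?case
        using map_permutation_id'[OF inj] permutes_id[of I] replacing_closure.id[of G]
        unfolding sym_group_one by (metis (mono_tags, lifting) mem_Collect_eq)
    next
      case (incl h)
      then show ?case
        using repl by (auto intro: replacing_closure_incl)
    next
      case (inv h)
      then have "h \<in> carrier ?S"
        by (simp add: sym_group_carrier I_def)
      then have "inv\<^bsub>?S\<^esub> h = inv' h"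
        by (rule sym_group_inv_equality)
      then show ?case
        using inv by (auto intro: replacing_closure_incl permutes_inv)
    next
      case (eng h1 h2)
      then have "h1 permutes I" "h2 permutes I"
        "?c h1 \<in> replacing_closure G" "?c h2 \<in> replacing_closure G"
        by simp_all
      then have "h1 \<circ> h2 permutes I" "?c (h1 \<circ> h2) \<in> replacing_closure G"
        unfolding comp[OF \<open>h2 permutes I\<close>]
        by (blast intro: permutes_compose, blast intro: replacing_closure_comp)
      then show ?case
        unfolding sym_group_mult by blast
    qed
  next
    let ?d = "map_permutation (verts G) (inv_into I v)"
    have v': "bij_betw (inv_into I v) (verts G) I"
      using v by (rule bij_betw_inv_into)
    have cd: "?c (?d p) = p" if "p permutes verts G" for p
      using map_permutation_compose_inv[OF v' that, of v] v
      by (metis bij_betw_inv_into_right)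
    have dc: "?d (?c s) = s" if "s permutes I" for s
      using map_permutation_compose_inv[OF v that, of "inv_into I v"] v
      by (metis bij_betw_inv_into_left)
    \<comment> \<open>The second conjunct strengthens the induction: \<open>?d\<close> splits over a
      composition once the right factor is known to permute the vertex set.\<close>
    have "?d p \<in> generate ?S ?gens \<and> p permutes verts G" if "p \<in> replacing_closure G" for p
      using that
    proof induction
      case id
      have "?d id = \<one>\<^bsub>?S\<^esub>"
        using v' by (simp add: bij_betw_def map_permutation_id' sym_group_one)
      then show ?case
        using generate.one[of ?S ?gens] permutes_id[of "verts G"] by metis
    next
      case (step p q)
      have p: "p permutes verts G"
        using step(1) unfolding replacing_perm_def by blast
      have dp: "?d p permutes I"
        using map_permutation_permutes[OF v' p] .
      have "?c (inv' (?d p)) = inv' p"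
        using c_inv[OF dp] cd[OF p] by simp
      then have "?d p \<in> ?gens"
        using dp replacing_perm_inv[OF G step(1)] by simp
      moreover have "?d (p \<circ> q) = ?d p \<circ> ?d q"
        using v' step.IH by (intro map_permutation_compose') (auto simp: bij_betw_def)
      ultimately have "?d (p \<circ> q) \<in> generate ?S ?gens"
        using step.IH generate.eng[OF generate.incl, of "?d p" ?gens "?d q" ?S]
        by (simp only: sym_group_mult)
      moreover have "p \<circ> q permutes verts G"
        using step.IH p by (blast intro: permutes_compose)
      ultimately show ?case ..
    qed
    moreover assume "s \<in> {s. s permutes I \<and> ?c s \<in> replacing_closure G}"
    ultimately show "s \<in> amoeba_group v G"
      unfolding gen using dc by force
  }
qed

text \<open>For each labelling the group condition becomes one that no longer mentions the
  labelling, so it remains only that some labelling exists, which finiteness ensures.\<close>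

lemma local_amoeba_iff:
  assumes G: "simple_graph G"
  shows "local_amoeba G \<longleftrightarrow> (\<forall>p. p permutes verts G \<longrightarrow> p \<in> replacing_closure G)"
proof -
  let ?I = "{1..card (verts G)}"
  have carrier: "carrier (sym_group (card (verts G))) = {s. s permutes ?I}"
    by (auto simp: sym_group_carrier)
  have "amoeba_group v G = carrier (sym_group (card (verts G))) \<longleftrightarrow>
      (\<forall>p. p permutes verts G \<longrightarrow> p \<in> replacing_closure G)" if lab: "labelling v G" for v
  proof -
    have v: "bij_betw v ?I (verts G)"
      using lab unfolding labelling_def .
    have v': "bij_betw (inv_into ?I v) (verts G) ?I"
      using v by (rule bij_betw_inv_into)
    \<comment> \<open>Transport is onto, so quantifying over label permutations and over vertex
      permutations amounts to the same.\<close>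
    have "\<exists>s. s permutes ?I \<and> map_permutation ?I v s = p" if "p permutes verts G" for p
      using map_permutation_permutes[OF v' that] map_permutation_compose_inv[OF v' that, of v] v
      by (metis bij_betw_inv_into_right)
    then show ?thesis
      unfolding amoeba_group_eq[OF G lab] carrier using map_permutation_permutes[OF v] by blast
  qed
  moreover have "\<exists>v. labelling v G"
    unfolding labelling_def using G ex_bij_betw_nat_finite_1 unfolding simple_graph_def by blast
  ultimately show ?thesis
    unfolding local_amoeba_def by blast
qed

section \<open>Gluing symmetric groups\<close>

text \<open>All transpositions through one point \<open>z\<close> generate the symmetric group.
  Those moving a point of \<open>A\<close> outside \<open>Y\<close> are conjugates under
  \<open>\<phi>\<close> of transpositions within \<open>Y\<close>, because \<open>\<phi>\<close>
  fixes \<open>z\<close>.\<close>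

lemma replacing_closure_full:
  assumes fin: "finite Y" "finite A"
    and Y: "\<And>p. p permutes Y \<Longrightarrow> p \<in> replacing_closure G"
    and phi: "\<phi> \<in> replacing_closure G" "\<phi> \<circ> \<phi> = id" "\<phi> ` A \<subseteq> Y"
    and z: "z \<in> Y" "\<phi> z = z"
    and p: "p permutes Y \<union> A"
  shows "p \<in> replacing_closure G"
proof -
  have tr_z: "Transposition.transpose a z \<in> replacing_closure G" if "a \<in> Y \<union> A" for a
  proof (cases "a \<in> Y")
    case True
    then show ?thesis
      using Y permutes_swap_id[of a Y z] z by blast
  next
    case False
    with that have "\<phi> a \<in> Y"
      using phi by blast
    then have "Transposition.transpose (\<phi> a) z \<in> replacing_closure G"
      using Y permutes_swap_id[of "\<phi> a" Y z] z by blast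
    then have "\<phi> \<circ> Transposition.transpose (\<phi> a) z \<circ> \<phi> \<in> replacing_closure G"
      using phi by (intro replacing_closure_comp)
    moreover have "\<phi> (\<phi> x) = x" for x
      using phi(2) by (rule pointfree_idE)
    then have "\<phi> \<circ> Transposition.transpose (\<phi> a) (\<phi> z) \<circ> \<phi> = Transposition.transpose a z"
      unfolding fun_eq_iff Transposition.transpose_def o_apply by metis
    ultimately show ?thesis
      using z by simp
  qed
  have tr: "Transposition.transpose a b \<in> replacing_closure G"
    if "a \<in> Y \<union> A" "b \<in> Y \<union> A" "a \<noteq> b" for a b
  proof (cases "a = z \<or> b = z")
    case True
    then show ?thesis
      using tr_z that by (metis transpose_commute)
  next
    case False
    then have "Transposition.transpose a b =
        Transposition.transpose a z \<circ> Transposition.transpose b z \<circ> Transposition.transpose a z"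
      using that(3) by (auto simp: fun_eq_iff Transposition.transpose_def)
    then show ?thesis
      using tr_z that by (simp add: replacing_closure_comp)
  qed
  have "finite (Y \<union> A)"
    using fin by simp
  from p this show ?thesis
  proof (induction rule: permutes_induct)
    case id
    show ?case
      by (rule replacing_closure.id)
  next
    case (swap a b p)
    then show ?case
      by (intro replacing_closure_comp tr)
  qed
qed

section \<open>Adding isolated vertices\<close>

lemma simple_graph_add_isolated:
  "simple_graph G \<Longrightarrow> simple_graph (add_isolated G t)"
  unfolding simple_graph_def add_isolated_def by (auto simp: card_image)

text \<open>Isolated vertices carry no edges, so extending by the identity preserves the
  replacement. This is how the swap of the two copies reaches the padded graph.\<close>

lemma replacing_perm_add_isolated:
  assumes "replacing_perm G p"
  shows "replacing_perm (add_isolated G t) (map_sum p id)"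
proof -
  obtain a b where p: "p permutes verts G" and a: "a \<in> edges G"
    and ab: "(`) p ` edges G = insert b (edges G - {a})"
    using assms unfolding replacing_perm_def by auto
  have inj: "inj ((`) (Inl :: 'a \<Rightarrow> 'a + nat))"
    by (simp add: inj_image_eq_iff inj_def)
  let ?m = "map_sum p (id :: nat \<Rightarrow> nat)"
  have "?m permutes verts (add_isolated G t)"
  proof (rule bij_imp_permutes)
    have "bij ?m"
      using permutes_bij[OF p]
      by (intro o_bij[of "map_sum (inv' p) id"])
        (simp_all only: map_sum.comp permutes_inv_o[OF p] map_sum.id id_o)
    moreover have "?m ` verts (add_isolated G t) = verts (add_isolated G t)"
    proof -
      have "?m ` Inl ` verts G = Inl ` p ` verts G" "?m ` Inr ` {..<t} = Inr ` {..<t}"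
        by (simp_all add: image_image)
      then show ?thesis
        unfolding add_isolated_def by (simp only: graph.sel image_Un permutes_image[OF p])
    qed
    ultimately show "bij_betw ?m (verts (add_isolated G t)) (verts (add_isolated G t))"
      by (rule bij_betw_subset[OF _ subset_UNIV])
    fix x assume "x \<notin> verts (add_isolated G t)"
    then show "?m x = x"
      using permutes_not_in[OF p] unfolding add_isolated_def by (cases x) auto
  qed
  moreover have "(`) ?m ` edges (add_isolated G t) = (`) Inl ` (`) p ` edges G"
    unfolding add_isolated_def by (simp add: image_image)
  then have "(`) ?m ` edges (add_isolated G t)
      = insert (Inl ` b) (edges (add_isolated G t) - {Inl ` a})"
    unfolding ab add_isolated_def by (simp add: image_set_diff[OF inj])
  moreover have "Inl ` a \<in> edges (add_isolated G t)"
    using a unfolding add_isolated_def by simp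
  ultimately show ?thesis
    unfolding replacing_perm_def by blast
qed

text \<open>Edges in \<open>D\<close> avoid the vertices that \<open>p\<close> moves and are
  therefore fixed. Since they differ from all edges of \<open>G\<close>, deleting \<open>a\<close>
  does not affect them.\<close>

lemma replacing_perm_supergraph:
  assumes "replacing_perm G p" "verts G \<subseteq> verts F" "edges F = edges G \<union> D"
    and "\<And>d. d \<in> D \<Longrightarrow> d \<inter> verts G = {} \<and> d \<notin> edges G"
  shows "replacing_perm F p"
proof -
  obtain a b where p: "p permutes verts G" and a: "a \<in> edges G"
    and ab: "(`) p ` edges G = insert b (edges G - {a})"
    using assms(1) unfolding replacing_perm_def by auto
  have "p ` d = d" if "d \<in> D" for d
    using assms(4)[OF that] permutes_not_in[OF p] by (force simp: image_iff)
  then have "(`) p ` D = D"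
    by (simp add: image_def)
  then have "(`) p ` edges F = insert b (edges F - {a})"
    using a ab assms(3,4) by (auto simp: image_Un)
  then show ?thesis
    unfolding replacing_perm_def using permutes_subset[OF p assms(2)] a assms(3) by blast
qed

lemma replacing_closure_supergraph:
  assumes "p \<in> replacing_closure G" "verts G \<subseteq> verts F" "edges F = edges G \<union> D"
    and "\<And>d. d \<in> D \<Longrightarrow> d \<inter> verts G = {} \<and> d \<notin> edges G"
  shows "p \<in> replacing_closure F"
  using assms(1)
proof induction
  case id
  show ?case
    by (rule replacing_closure.id)
next
  case (step p q)
  then show ?case
    using replacing_perm_supergraph[OF _ assms(2-4)] by (intro replacing_closure.step)
qed

section \<open>Swapping the two copies\<close>

text \<open>Here \<open>K\<close> stands for \<open>H\<close> with an edge added or deleted. The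
  amoeba property of \<open>G\<close> gives all permutations that fix \<open>K\<close> pointwise,
  and \<open>\<phi>\<close> supplies the rest through \<open>replacing_closure_full\<close>.\<close>

lemma global_amoeba_union:
  assumes G: "simple_graph G" "global_amoeba G" and K: "simple_graph K"
    and disj: "verts K \<inter> verts G = {}"
    and phi: "replacing_perm (G \<union>\<^sub>g K) \<phi>" "\<phi> \<circ> \<phi> = id" "\<phi> ` verts K \<subseteq> verts G"
  shows "global_amoeba (G \<union>\<^sub>g K)"
proof -
  obtain T where T: "\<And>t. t \<ge> T \<Longrightarrow> local_amoeba (add_isolated G t)"
    using G(2) unfolding global_amoeba_def by blast
  have F: "simple_graph (G \<union>\<^sub>g K)"
    using G(1) K unfolding simple_graph_def graph_union_def by auto
  \<comment> \<open>The extra unit over \<open>T\<close> guarantees an isolated vertex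
    \<open>Inr 0\<close>, which serves as the common point \<open>z\<close> fixed by the extended
    swap.\<close>
  have "local_amoeba (add_isolated (G \<union>\<^sub>g K) t)" if t: "t \<ge> Suc T" for t
  proof -
    let ?F = "add_isolated (G \<union>\<^sub>g K) t"
    let ?Y = "verts (add_isolated G t)"
    let ?A = "Inl ` verts K"
    have X: "verts ?F = ?Y \<union> ?A"
      unfolding add_isolated_def graph_union_def by auto
    have D: "edges ?F = edges (add_isolated G t) \<union> (`) Inl ` edges K"
      unfolding add_isolated_def graph_union_def by (simp add: image_Un)
    have K_edge: "d \<inter> ?Y = {} \<and> d \<notin> edges (add_isolated G t)" if "d \<in> (`) Inl ` edges K" for d
    proof -
      obtain e where e: "e \<in> edges K" "d = Inl ` e"
        using \<open>d \<in> _\<close> by blast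
      then have "e \<subseteq> verts K" "e \<noteq> {}"
        using K unfolding simple_graph_def by auto
      then have *: "d \<inter> ?Y = {}" "d \<noteq> {}"
        using disj e(2) unfolding add_isolated_def by auto
      moreover have "d \<subseteq> ?Y" if "d \<in> edges (add_isolated G t)"
        using simple_graph_add_isolated[OF G(1)] that unfolding simple_graph_def by blast
      ultimately show ?thesis
        by blast
    qed
    have Y: "p \<in> replacing_closure ?F" if "p permutes ?Y" for p
    proof (rule replacing_closure_supergraph[OF _ _ D K_edge])
      show "p \<in> replacing_closure (add_isolated G t)"
        using T[of t] t that local_amoeba_iff[OF simple_graph_add_isolated[OF G(1)]] by auto
      show "?Y \<subseteq> verts ?F"
        using X by blast
    qed
    have "p \<in> replacing_closure ?F" if p: "p permutes ?Y \<union> ?A" for p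
    proof (rule replacing_closure_full[of ?Y ?A ?F "map_sum \<phi> id" "Inr 0"])
      show "finite ?Y" "finite ?A"
        using simple_graph_add_isolated[OF G(1)] K unfolding simple_graph_def by blast+
      show "map_sum \<phi> id \<in> replacing_closure ?F"
        using replacing_perm_add_isolated[OF phi(1)] by (rule replacing_closure_incl)
      show "map_sum \<phi> id \<circ> map_sum \<phi> id = id"
        by (simp only: map_sum.comp phi(2) map_sum.id id_o)
      show "map_sum \<phi> id ` ?A \<subseteq> ?Y"
        using phi(3) unfolding add_isolated_def by auto
      show "Inr 0 \<in> ?Y"
        using t unfolding add_isolated_def by simp
    qed (use Y p in auto)
    then show ?thesis
      using local_amoeba_iff[OF simple_graph_add_isolated[OF F]] X by auto
  qed
  then show ?thesis
    unfolding global_amoeba_def by blast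
qed

text \<open>Glue \<open>f\<close> on \<open>A\<close> with its inverse on \<open>B\<close> and the
  identity elsewhere. Being self-inverse, the result is bijective.\<close>

lemma ex_swapping_involution:
  assumes f: "bij_betw f A B" and disj: "A \<inter> B = {}"
  obtains \<phi> where "\<phi> permutes A \<union> B" "\<phi> \<circ> \<phi> = id" "\<And>x. x \<in> A \<Longrightarrow> \<phi> x = f x"
proof
  define \<phi> where "\<phi> x = (if x \<in> A then f x else if x \<in> B then inv_into A f x else x)" for x
  have fA: "f x \<in> B" "inv_into A f (f x) = x" if "x \<in> A" for x
    using that f by (auto simp: bij_betw_inv_into_left bij_betw_apply)
  have fB: "inv_into A f x \<in> A" "f (inv_into A f x) = x" if "x \<in> B" for x
    using that f by (auto simp: bij_betw_inv_into_right bij_betw_def inv_into_into)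
  show inv: "\<phi> \<circ> \<phi> = id"
    using fA fB disj by (fastforce simp: \<phi>_def fun_eq_iff)
  have "bij \<phi>"
    using inv inv by (rule o_bij)
  then show "\<phi> permutes A \<union> B"
    unfolding permutes_def bij_iff \<phi>_def by auto
  show "\<phi> x = f x" if "x \<in> A" for x
    using that by (simp add: \<phi>_def)
qed

theorem theorem4p4:
  fixes G H H' H'' :: "'a graph"
  assumes "simple_graph G" and "simple_graph H'" and "simple_graph H''" and "simple_graph H"
    and "global_amoeba G"
    and "G = H' \<union>\<^sub>g H''" and "verts H' \<inter> verts H'' = {}"
    and "H \<cong>\<^sub>g H'" and "verts H \<inter> verts G = {}"
  shows "(\<forall>e\<in>edges (graph_compl H). global_amoeba (G \<union>\<^sub>g add_edge H e)) \<and>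
         (\<forall>e\<in>edges H. global_amoeba (G \<union>\<^sub>g del_edge H e))"
proof -
  have vG: "verts G = verts H' \<union> verts H''" and eG: "edges G = edges H' \<union> edges H''"
    using assms(6) by (auto simp: graph_union_def)
  obtain f where f: "bij_betw f (verts H) (verts H')"
    and iso: "\<And>u w. u \<in> verts H \<Longrightarrow> w \<in> verts H \<Longrightarrow>
      {u, w} \<in> edges H \<longleftrightarrow> {f u, f w} \<in> edges H'"
    using assms(8) unfolding graph_iso_def by blast
  have "verts H \<inter> verts H' = {}"
    using assms(9) vG by blast
  then obtain \<phi> where phi: "\<phi> permutes verts H \<union> verts H'" "\<phi> \<circ> \<phi> = id"
    and phi_f: "\<And>x. x \<in> verts H \<Longrightarrow> \<phi> x = f x"
    using ex_swapping_involution[OF f] by blast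
  have phi_sub: "\<phi> ` verts H \<subseteq> verts H'"
    using f phi_f by (auto simp: bij_betw_def)
  have phi_phi: "\<phi> ` \<phi> ` e = e" for e
    using phi(2) by (simp add: image_comp)
  have swap: "(`) \<phi> ` edges H = edges H'"
  proof (intro equalityI subsetI)
    fix e assume "e \<in> (`) \<phi> ` edges H"
    then obtain d where d: "d \<in> edges H" "e = \<phi> ` d"
      by blast
    obtain x y where "d = {x, y}" "x \<in> verts H" "y \<in> verts H"
      using simple_graph_edgeE[OF assms(4) d(1)] by metis
    then show "e \<in> edges H'"
      using d iso phi_f by simp
  next
    fix e assume e: "e \<in> edges H'"
    obtain x y where xy: "e = {x, y}" "x \<in> verts H'" "y \<in> verts H'"
      using simple_graph_edgeE[OF assms(2) e] by metis
    then obtain u w where "u \<in> verts H" "w \<in> verts H" "x = f u" "y = f w"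
      using f unfolding bij_betw_def by blast
    then have "{u, w} \<in> edges H" "e = \<phi> ` {u, w}"
      using iso e xy phi_f by auto
    then show "e \<in> (`) \<phi> ` edges H"
      by blast
  qed
  then have swap': "(`) \<phi> ` edges H' = edges H"
    by (metis (no_types, lifting) image_cong image_ident image_image phi_phi)
  have "\<phi> ` e = e" if "e \<in> edges H''" for e
  proof -
    have "e \<inter> (verts H \<union> verts H') = {}"
      using that assms(3,7,9) vG unfolding simple_graph_def by blast
    then show ?thesis
      using permutes_not_in[OF phi(1)] by (force simp: image_iff)
  qed
  then have fix'': "(`) \<phi> ` edges H'' = edges H''"
    by (simp add: image_def)
  have inj: "inj ((`) \<phi>)"
    by (metis injI phi_phi)
  \<comment> \<open>An edge of \<open>G\<close> lies within the vertices of \<open>G\<close>, which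
    a nonempty set of vertices of \<open>H\<close> cannot do.\<close>
  have notin: "e \<notin> edges G" if "e \<subseteq> verts H" "e \<noteq> {}" for e
    using that assms(1,9) unfolding simple_graph_def by blast
  have edge_H: "e \<subseteq> verts H" "e \<noteq> {}" if "e \<in> edges H" for e
    using that assms(4) unfolding simple_graph_def by auto
  have permF: "\<phi> permutes verts (G \<union>\<^sub>g K)" if "verts K = verts H" for K
    using permutes_subset[OF phi(1)] vG that unfolding graph_union_def by auto
  \<comment> \<open>Both claims now reduce to computing the image of the edge set under
    \<open>\<phi>\<close>: \<open>a\<close> is the edge lost and \<open>b\<close> the edge
    gained.\<close>
  have main: "global_amoeba (G \<union>\<^sub>g K)"
    if K: "simple_graph K" "verts K = verts H" and ab: "a \<in> edges (G \<union>\<^sub>g K)"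
      "(`) \<phi> ` edges (G \<union>\<^sub>g K) = insert b (edges (G \<union>\<^sub>g K) - {a})" for K a b
  proof (rule global_amoeba_union[OF assms(1,5) K(1)])
    show "replacing_perm (G \<union>\<^sub>g K) \<phi>"
      unfolding replacing_perm_def using permF[OF K(2)] ab by blast
  qed (use K(2) assms(9) phi phi_sub vG in auto)
  show ?thesis
  proof (intro conjI ballI)
    fix e assume "e \<in> edges (graph_compl H)"
    then obtain u w where e: "e = {u, w}" "u \<in> verts H" "w \<in> verts H" "u \<noteq> w" "e \<notin> edges H"
      unfolding graph_compl_def by auto
    have new: "e \<notin> edges G"
      using e by (intro notin) auto
    show "global_amoeba (G \<union>\<^sub>g add_edge H e)"
    proof (rule main)
      show "simple_graph (add_edge H e)"
        using assms(4) e unfolding simple_graph_def add_edge_def by auto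
      show "verts (add_edge H e) = verts H"
        by (simp add: add_edge_def)
      show "e \<in> edges (G \<union>\<^sub>g add_edge H e)"
        by (simp add: graph_union_def add_edge_def)
      show "(`) \<phi> ` edges (G \<union>\<^sub>g add_edge H e) =
          insert (\<phi> ` e) (edges (G \<union>\<^sub>g add_edge H e) - {e})"
        using e(5) new
        by (auto simp: graph_union_def add_edge_def eG image_Un swap swap' fix'')
    qed
  next
    fix e assume e: "e \<in> edges H"
    have e': "\<phi> ` e \<in> edges H'"
      using e swap by blast
    have "\<phi> ` e \<notin> edges H"
      using notin[of "\<phi> ` e"] edge_H[of "\<phi> ` e"] e' eG by auto
    moreover have "\<phi> ` e \<notin> edges H''"
    proof
      assume "\<phi> ` e \<in> edges H''"
      then have "\<phi> ` e \<subseteq> verts H''"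
        using assms(3) unfolding simple_graph_def by simp
      moreover have "\<phi> ` e \<subseteq> verts H'"
        using e' assms(2) unfolding simple_graph_def by simp
      ultimately have "\<phi> ` e = {}"
        using assms(7) by blast
      then show False
        using edge_H(2)[OF e] by simp
    qed
    ultimately have old: "\<phi> ` e \<notin> edges H \<union> edges H''"
      by blast
    show "global_amoeba (G \<union>\<^sub>g del_edge H e)"
    proof (rule main)
      show "simple_graph (del_edge H e)"
        using assms(4) unfolding simple_graph_def del_edge_def by auto
      show "verts (del_edge H e) = verts H"
        by (simp add: del_edge_def)
      show "\<phi> ` e \<in> edges (G \<union>\<^sub>g del_edge H e)"
        using e' eG by (simp add: graph_union_def)
      have "(`) \<phi> ` edges (G \<union>\<^sub>g del_edge H e) =
          edges H \<union> edges H'' \<union> (edges H' - {\<phi> ` e})"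
        by (simp add: graph_union_def del_edge_def eG image_Un swap swap' fix''
            image_set_diff[OF inj])
      also have "\<dots> = insert e (edges (G \<union>\<^sub>g del_edge H e) - {\<phi> ` e})"
        using e old by (auto simp: graph_union_def del_edge_def eG)
      finally show "(`) \<phi> ` edges (G \<union>\<^sub>g del_edge H e) =
          insert e (edges (G \<union>\<^sub>g del_edge H e) - {\<phi> ` e})" .
    qed
  qed
qed

end
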